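(* Let $\Omega_i=\mathbb R^p$ for all $i$. Suppose the graph $\mathcal G$ is connected, $\mathbf L=U^\top U$ satisfies the graph and null-space conditions given in the context, each $f_i$ is differentiable with $L_i$-Lipschitz gradient, and each $f_i$ is $\mu_i$-strongly convex ($\mu_i>0$). Let the parameters $\beta_i>0$ and $c>0$ of Mirror-P-EXTRA be such that $B\succcurlyeq c\mathbf L$. Then $\{\mathbf z^k\}$ converges to $\mathbf z^*$ with Q-linear rate in the (pseudo)metric induced by $\mathcal M$: there is $\delta>0$ such that for all $k\ge0$ $$\|\mathbf z^{k+1}-\mathbf z^*\|_{\mathcal M}^2\le\frac1{1+\delta}\|\mathbf z^k-\mathbf z^*\|_{\mathcal M}^2 .$$ Consequently, $\{\mathbf x^k\}$ converges to the optimal solution $\mathbf x^*$ of the resource allocation problem at an R-linear rate: $\|\mathbf x^{k}-\mathbf x^*\|_{\mathrm F}^2=O\big((\tfrac1{1+\delta})^k\big)$.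
   Context: Problem. There are $n$ agents; agent $i$ has $f_i:\mathbb R^p\to\mathbb R$ and $r_i\in\mathbb R^p$. The (unconstrained, $\Omega_i=\mathbb R^p$) resource allocation problem is: minimize $\mathbf f(\mathbf x)=\sum_{i=1}^n f_i(x_i)$ subject to $\sum_{i=1}^n(x_i-r_i)=0$. Points are matrices $\mathbf x\in\mathbb R^{n\times p}$ with $i$-th row $x_i^\top$; $\mathbf r$ has rows $r_i^\top$; $\nabla\mathbf f(\mathbf x)$ is the matrix with rows $(\nabla f_i(x_i))^\top$. A function $f$ is $\mu$-strongly convex if $\langle \nabla f(x)-\nabla f(y),x-y\rangle\ge\mu\|x-y\|_2^2$ for all $x,y$. Graph. $\mathcal G$ is a simple undirected graph on $\{1,\dots,n\}$ with edge set $\mathcal E$ and neighbor sets $\mathcal N_i$. The $n\times n$ matrix $\mathbf L=[L_{ij}]$ is compatible with $\mathcal G$ (that is, $L_{ij}=0$ whenever $i\ne j$ and $\{i,j\}\notin\mathcal E$) and $\mathbf L=U^\top U$ for some full-row-rank $U\in\mathbb R^{(n-1)\times n}$ with null space $\{a\mathbf 1: a\in\mathbb R\}$. Algorithm (Mirror-P-EXTRA, with $\Omega_i=\mathbb R^p$). Each agent $i$ has $\beta_i>0$; all share $c>0$; $B=\mathrm{diag}(\beta_1,\dots,\beta_n)$. Initialize $x_i^0\in\mathbb R^p$, $s_i^0=\nabla f_i(x_i^0)$, $y_i^{-1}=0$. For $k=0,1,\dots$: $y_i^k=y_i^{k-1}+\sum_{j\in\mathcal N_i\cup\{i\}}L_{ij}s_j^k$;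 $x_i^{k+1}=\arg\min_{x_i\in\mathbb R^p}\{f_i(x_i)-\langle s_i^k,x_i\rangle+\frac1{2\beta_i}\|x_i-r_i+2cy_i^k-cy_i^{k-1}\|_2^2\}$; $s_i^{k+1}=s_i^k-\frac1{\beta_i}(x_i^{k+1}-r_i+2cy_i^k-cy_i^{k-1})$. Define $\mathbf q^{-1}=0$, $\mathbf q^{k}=\mathbf q^{k-1}+U\nabla\mathbf f(\mathbf x^k)$ for $k\ge0$, and $$\mathcal M=\begin{pmatrix}cI&0\\0&B-c\mathbf L\end{pmatrix},\quad \mathbf z^k=\begin{pmatrix}\mathbf q^k\\ \nabla\mathbf f(\mathbf x^k)\end{pmatrix},\quad \mathbf z^*=\begin{pmatrix}\mathbf q^*\\ \nabla\mathbf f(\mathbf x^* )\end{pmatrix},$$ where $\mathbf x^*$ is the optimal solution and $\mathbf q^*\in\mathbb R^{(n-1)\times p}$ satisfies $\mathbf x^*-\mathbf r+cU^\top\mathbf q^*=0$ (and $U\nabla\mathbf f(\mathbf x^* )=0$). $\|A\|_{\mathcal M}=\sqrt{\mathrm{Trace}(A^\top\mathcal MA)}$ (a seminorm when $\mathcal M$ is positive semidefinite). *)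

theory Defs
  imports "HOL-Analysis.Analysis" "HOL-Library.Landau_Symbols"
begin

text \<open>
  Agents are the elements of a finite type \<open>'n\<close>, and an $n \times p$ matrix is an element of
  \<open>real^'p^'n\<close>, so that \<open>x $ i\<close> is its \<open>i\<close>-th row; \<open>norm\<close> on this type is the Frobenius norm.

  The row index of $U \in \mathbb{R}^{(n-1)\times n}$ ranges over \<open>{..<CARD('n) - 1}\<close>: \<open>U k\<close> is the
  \<open>k\<close>-th row, and \<open>q k\<close> is the \<open>k\<close>-th row of a matrix $q \in \mathbb{R}^{(n-1)\times p}$.  Values at
  \<open>k \<ge> CARD('n) - 1\<close> are irrelevant and never inspected.  A type as row index would exclude the
  case of a single agent, as types are nonempty.
\<close>

definition gradient :: "('a::real_inner \<Rightarrow> real) \<Rightarrow> 'a \<Rightarrow> 'a" where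
  "gradient f x = (THE D. GDERIV f x :> D)"

definition strongly_convex :: "real \<Rightarrow> ('a::real_inner \<Rightarrow> real) \<Rightarrow> bool" where
  "strongly_convex \<mu> f \<longleftrightarrow>
     (\<forall>x y. (gradient f x - gradient f y) \<bullet> (x - y) \<ge> \<mu> * (norm (x - y))\<^sup>2)"

definition Grad :: "('n \<Rightarrow> real^'p \<Rightarrow> real) \<Rightarrow> real^'p^'n \<Rightarrow> real^'p^'n" where
  "Grad f x = (\<chi> i. gradient (f i) (x $ i))"

definition optimal_allocation ::
    "('n::finite \<Rightarrow> real^'p \<Rightarrow> real) \<Rightarrow> real^'p^'n \<Rightarrow> real^'p^'n \<Rightarrow> bool" where
  "optimal_allocation f r x \<longleftrightarrow>
     is_arg_min (\<lambda>x. \<Sum>i\<in>UNIV. f i (x $ i)) (\<lambda>x. (\<Sum>i\<in>UNIV. x $ i - r $ i) = 0) x"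

definition simple_graph :: "'n set set \<Rightarrow> bool" where
  "simple_graph E \<longleftrightarrow> (\<forall>e\<in>E. card e = 2)"

definition neighbors :: "'n set set \<Rightarrow> 'n \<Rightarrow> 'n set" where
  "neighbors E i = {j. {i, j} \<in> E}"

definition connected_graph :: "'n set set \<Rightarrow> bool" where
  "connected_graph E \<longleftrightarrow> (\<forall>i j. (i, j) \<in> {(u, v). {u, v} \<in> E}\<^sup>*)"

definition compatible :: "'n set set \<Rightarrow> real^'n^'n \<Rightarrow> bool" where
  "compatible E L \<longleftrightarrow> (\<forall>i j. i \<noteq> j \<and> {i, j} \<notin> E \<longrightarrow> L $ i $ j = 0)"

definition full_row_rank :: "(nat \<Rightarrow> real^'n) \<Rightarrow> bool" where
  "full_row_rank U \<longleftrightarrow> dim (U ` {..<CARD('n) - 1}) = CARD('n) - 1"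

definition null_space :: "(nat \<Rightarrow> real^'n) \<Rightarrow> (real^'n) set" where
  "null_space U = {v. \<forall>k<CARD('n) - 1. U k \<bullet> v = 0}"

definition gram :: "(nat \<Rightarrow> real^'n) \<Rightarrow> real^'n^'n" where \<comment> \<open>$U^\top U$\<close>
  "gram U = (\<chi> i j. \<Sum>k<CARD('n) - 1. U k $ i * U k $ j)"

definition U_mult :: "(nat \<Rightarrow> real^'n) \<Rightarrow> real^'p^'n \<Rightarrow> nat \<Rightarrow> real^'p" where \<comment> \<open>$U G$\<close>
  "U_mult U G k = (\<Sum>j\<in>UNIV. U k $ j *\<^sub>R G $ j)"

definition Ut_mult :: "(nat \<Rightarrow> real^'n) \<Rightarrow> (nat \<Rightarrow> real^'p) \<Rightarrow> real^'p^'n" where \<comment> \<open>$U^\top q$\<close>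
  "Ut_mult U q = (\<chi> i. \<Sum>k<CARD('n) - 1. U k $ i *\<^sub>R q k)"

definition diag :: "('n \<Rightarrow> real) \<Rightarrow> real^'n^'n" where
  "diag \<beta> = (\<chi> i j. if i = j then \<beta> i else 0)"

definition psd :: "real^'n^'n \<Rightarrow> bool" where
  "psd A \<longleftrightarrow> transpose A = A \<and> (\<forall>v. 0 \<le> v \<bullet> (A *v v))"

text \<open>
  The sequence \<open>y\<close> is shifted by one: \<open>y k\<close> stands for $y^{k-1}$, so \<open>y 0\<close> is $y^{-1}$ and
  \<open>y (Suc k)\<close> is $y^k$.
\<close>

definition mirror_P_EXTRA ::
    "('n::finite \<Rightarrow> real^'p \<Rightarrow> real) \<Rightarrow> real^'p^'n \<Rightarrow> 'n set set \<Rightarrow> real^'n^'n \<Rightarrow> ('n \<Rightarrow> real) \<Rightarrow> real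
      \<Rightarrow> (nat \<Rightarrow> real^'p^'n) \<Rightarrow> (nat \<Rightarrow> real^'p^'n) \<Rightarrow> (nat \<Rightarrow> real^'p^'n) \<Rightarrow> bool" where
  "mirror_P_EXTRA f r E L \<beta> c x s y \<longleftrightarrow>
     (\<forall>i. s 0 $ i = gradient (f i) (x 0 $ i)) \<and>
     (\<forall>i. y 0 $ i = 0) \<and>
     (\<forall>k i. y (Suc k) $ i = y k $ i + (\<Sum>j\<in>neighbors E i \<union> {i}. L $ i $ j *\<^sub>R s k $ j)) \<and>
     (\<forall>k i. is_arg_min
        (\<lambda>v. f i v - s k $ i \<bullet> v
           + 1 / (2 * \<beta> i)
             * (norm (v - r $ i + (2 * c) *\<^sub>R y (Suc k) $ i - c *\<^sub>R y k $ i))\<^sup>2)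
        (\<lambda>_. True) (x (Suc k) $ i)) \<and>
     (\<forall>k i. s (Suc k) $ i = s k $ i
        - (1 / \<beta> i)
          *\<^sub>R (x (Suc k) $ i - r $ i + (2 * c) *\<^sub>R y (Suc k) $ i - c *\<^sub>R y k $ i))"

primrec q_seq ::
    "('n::finite \<Rightarrow> real^'p \<Rightarrow> real) \<Rightarrow> (nat \<Rightarrow> real^'n) \<Rightarrow> (nat \<Rightarrow> real^'p^'n)
      \<Rightarrow> nat \<Rightarrow> nat \<Rightarrow> real^'p" where
  "q_seq f U x 0 = U_mult U (Grad f (x 0))" \<comment> \<open>as $q^{-1} = 0$\<close>
| "q_seq f U x (Suc k) = (\<lambda>a. q_seq f U x k a + U_mult U (Grad f (x (Suc k))) a)"

text \<open>
  Matrices with $(n-1)+n$ rows are indexed by \<open>{..<CARD('n) - 1} <+> UNIV\<close>, a subset of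
  \<open>nat + 'n\<close>; as above, rows are vectors in \<open>real^'p\<close>.
\<close>

definition stack :: "(nat \<Rightarrow> real^'p) \<Rightarrow> real^'p^'n \<Rightarrow> nat + 'n \<Rightarrow> real^'p" where
  "stack q G = case_sum q (\<lambda>i. G $ i)"

definition M_mat :: "real^'n^'n \<Rightarrow> ('n \<Rightarrow> real) \<Rightarrow> real \<Rightarrow> nat + 'n \<Rightarrow> nat + 'n \<Rightarrow> real" where
  "M_mat L \<beta> c a b =
     (case (a, b) of
        (Inl k, Inl l) \<Rightarrow> if k = l then c else 0
      | (Inr i, Inr j) \<Rightarrow> (diag \<beta> - c *\<^sub>R L) $ i $ j
      | _ \<Rightarrow> 0)"

definition M_norm ::
    "(nat + 'n::finite \<Rightarrow> nat + 'n \<Rightarrow> real) \<Rightarrow> (nat + 'n \<Rightarrow> real^'p) \<Rightarrow> real" where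
    \<comment> \<open>the argument of \<open>trace\<close> is the $p \times p$ matrix $A^\top M A$\<close>
  "M_norm M A =
     (let I = {..<CARD('n) - 1} <+> (UNIV :: 'n set)
      in sqrt (trace ((\<chi> d e. \<Sum>a\<in>I. \<Sum>b\<in>I. A a $ d * M a b * A b $ e) :: real^'p^'p)))"

end

theory Submission
  imports Defs
begin

text \<open>
  Write $g^k = \nabla f(x^k)$, $P = B - cL$, and $g^*$ for the gradient at the optimum.  The
  optimality condition of each local minimisation says $s^k = g^k$
  (\<open>mirror_P_EXTRA_s_eq_Grad\<close>), and summing the dual updates gives $y^k = U^\top q^k$
  (\<open>mirror_P_EXTRA_y_eq_Ut_q\<close>).  Subtracting the optimality conditions of $x^*$, the algorithm
  becomes a proximal point step in the seminorm of $M$: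
  \[ x^{k+1} - x^* + c U^\top (q^{k+1} - q^*) = P (g^k - g^{k+1}), \qquad
     q^{k+1} - q^k = U (g^{k+1} - g^*). \]
  The second equation uses $U g^* = 0$ (\<open>U_mult_optimal_gradient\<close>).  Pairing the first one with
  $g^{k+1} - g^*$ yields the descent identity (\<open>energy_descent\<close>)
  \[ \|z^k - z^*\|_M^2 = \|z^{k+1} - z^*\|_M^2 + \|z^k - z^{k+1}\|_M^2
       + 2 \langle x^{k+1} - x^*, g^{k+1} - g^* \rangle . \]

  The rate is linear because the two gains on the right control the remaining error,
  \[ \|z^{k+1} - z^*\|_M^2 \le C \bigl( \|z^k - z^{k+1}\|_M^2
       + 2 \langle x^{k+1} - x^*, g^{k+1} - g^* \rangle \bigr) \]
  (\<open>energy_error_bound\<close>); then $\delta = 1/C$.  For the gradient component this is Lipschitz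
  continuity followed by strong convexity.  For the dual component, full row rank of $U$ bounds
  $q^{k+1} - q^*$ by $U^\top (q^{k+1} - q^*)$ (\<open>Ut_mult_bounded_below\<close>), which the first equation
  expresses by $x^{k+1} - x^*$ and $P (g^k - g^{k+1})$; since $P$ is positive semidefinite, the norm
  of the latter is bounded by the $P$-seminorm of $g^k - g^{k+1}$
  (\<open>self_adjoint_nonneg_bounds\<close>).

  By the descent identity and strong convexity, $\|x^{k+1} - x^*\|^2$ is at most a constant times
  $\|z^k - z^*\|_M^2$, so the iterates inherit the rate even where $M$ is singular.
\<close>

section \<open>Gradients and minimisers\<close>

lemma has_derivative_gradient:
  fixes f :: "'a::euclidean_space \<Rightarrow> real"
  assumes "f differentiable (at v)"
  shows "(f has_derivative (\<lambda>h. h \<bullet> gradient f v)) (at v)"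
proof -
  obtain f' where f': "(f has_derivative f') (at v)"
    using assms unfolding differentiable_def by blast
  have "linear f'" using f' has_derivative_linear by blast
  then have "h \<bullet> adjoint f' 1 = f' h" for h
    using adjoint_works[of f' h 1] by simp
  then have ex: "GDERIV f v :> adjoint f' 1"
    using f' by (simp add: gderiv_def)
  have unique: "D = adjoint f' 1" if "GDERIV f v :> D" for D
  proof -
    have "(\<lambda>h. h \<bullet> D) = (\<lambda>h. h \<bullet> adjoint f' 1)"
      using that ex unfolding gderiv_def by (rule has_derivative_unique)
    then have "\<forall>h. h \<bullet> D = h \<bullet> adjoint f' 1" by (simp add: fun_eq_iff)
    then show ?thesis by (simp only: vector_eq_ldot)
  qed
  have "GDERIV f v :> gradient f v"
    unfolding gradient_def using ex unique by (rule theI)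
  then show ?thesis by (simp add: gderiv_def)
qed

text \<open>
  The stationarity condition of one local minimisation of the algorithm, with \<open>w\<close> standing for
  the shift $-r_i + 2cy_i^k - cy_i^{k-1}$; the right-hand side is exactly the update of $s_i$.
\<close>

lemma gradient_at_regularised_min:
  fixes f :: "'a::euclidean_space \<Rightarrow> real"
  assumes diff: "f differentiable (at v)" and "b > 0"
    and min: "is_arg_min (\<lambda>v. f v - s \<bullet> v + 1 / (2 * b) * (norm (v + w))\<^sup>2) (\<lambda>_. True) v"
  shows "gradient f v = s - (1 / b) *\<^sub>R (v + w)"
proof -
  define a where "a = 1 / (2 * b)"
  let ?F = "\<lambda>v. f v - s \<bullet> v + a * ((v + w) \<bullet> (v + w))"
  let ?D = "gradient f v - s + (2 * a) *\<^sub>R (v + w)"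
  have "(?F has_derivative (\<lambda>h. h \<bullet> gradient f v - s \<bullet> h
            + a * ((v + w) \<bullet> h + h \<bullet> (v + w)))) (at v)"
    by (auto intro!: derivative_eq_intros has_derivative_gradient[OF diff])
  moreover have "(\<lambda>h. h \<bullet> gradient f v - s \<bullet> h + a * ((v + w) \<bullet> h + h \<bullet> (v + w)))
      = (\<lambda>h. h \<bullet> ?D)"
    by (intro ext) (simp add: inner_simps inner_commute algebra_simps)
  ultimately have "(?F has_derivative (\<lambda>h. h \<bullet> ?D)) (at v)" by (rule has_derivative_eq_rhs)
  moreover have "\<forall>u. ?F v \<le> ?F u"
    using min by (simp add: is_arg_min_linorder power2_norm_eq_inner a_def)
  ultimately have "(\<lambda>h. h \<bullet> ?D) = (\<lambda>h. 0)"
    by (intro has_derivative_local_min) auto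
  from fun_cong[OF this, of ?D] have "?D = 0" by (simp only: inner_eq_zero_iff)
  moreover have "gradient f v = ?D + (s - (2 * a) *\<^sub>R (v + w))" by (simp only: algebra_simps)
  ultimately have "gradient f v = s - (2 * a) *\<^sub>R (v + w)" by (simp only: add_0_left)
  then show ?thesis by (simp add: a_def)
qed

lemma inner_vec_rows: "x \<bullet> y = (\<Sum>i\<in>UNIV. x $ i \<bullet> y $ i)" for x y :: "real^'p^'n"
  by (simp add: inner_vec_def)

text \<open>
  Moving the optimum along a direction \<open>D\<close> whose rows sum to zero keeps it feasible, so the
  directional derivative of the objective along \<open>D\<close> vanishes.
\<close>

lemma optimal_allocation_orthogonal:
  fixes f :: "'n::finite \<Rightarrow> real^'p \<Rightarrow> real"
  assumes diff: "\<And>i v. f i differentiable (at v)"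
    and opt: "optimal_allocation f r xs"
    and D: "(\<Sum>i\<in>UNIV. D $ i) = 0"
  shows "D \<bullet> Grad f xs = 0"
proof -
  let ?F = "\<lambda>t. \<Sum>i\<in>UNIV. f i (xs $ i + t *\<^sub>R D $ i)"
  have "((\<lambda>t. f i (xs $ i + t *\<^sub>R D $ i)) has_derivative
      (\<lambda>t. (t *\<^sub>R D $ i) \<bullet> gradient (f i) (xs $ i))) (at 0)" for i
  proof -
    have "((\<lambda>t. xs $ i + t *\<^sub>R D $ i) has_derivative (\<lambda>t. t *\<^sub>R D $ i)) (at 0)"
      by (auto intro!: derivative_eq_intros)
    then show ?thesis
      by (rule has_derivative_compose) (simp add: has_derivative_gradient diff)
  qed
  then have "(?F has_derivative (\<lambda>t. \<Sum>i\<in>UNIV. (t *\<^sub>R D $ i) \<bullet> gradient (f i) (xs $ i))) (at 0)"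
    by (intro has_derivative_sum)
  moreover have "?F 0 \<le> ?F t" for t
  proof -
    have "(\<Sum>i\<in>UNIV. (xs + t *\<^sub>R D) $ i - r $ i)
        = (\<Sum>i\<in>UNIV. xs $ i - r $ i) + t *\<^sub>R (\<Sum>i\<in>UNIV. D $ i)"
      by (simp add: sum.distrib[symmetric] scaleR_sum_right algebra_simps)
    also have "\<dots> = 0"
      using opt D by (simp add: optimal_allocation_def is_arg_min_linorder)
    finally have "(\<Sum>i\<in>UNIV. f i (xs $ i)) \<le> (\<Sum>i\<in>UNIV. f i ((xs + t *\<^sub>R D) $ i))"
      using opt unfolding optimal_allocation_def is_arg_min_linorder by blast
    then show ?thesis by simp
  qed
  ultimately have
    "(\<lambda>t. \<Sum>i\<in>UNIV. (t *\<^sub>R D $ i) \<bullet> gradient (f i) (xs $ i)) = (\<lambda>t. 0)"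
    by (intro has_derivative_local_min) auto
  from fun_cong[OF this, of 1] show ?thesis
    by (simp add: inner_vec_rows Grad_def)
qed

section \<open>Matrices acting on rows\<close>

definition apply_rows :: "real^'n^'n \<Rightarrow> real^'p^'n \<Rightarrow> real^'p^'n" where
  "apply_rows A G = (\<chi> i. \<Sum>j\<in>UNIV. A $ i $ j *\<^sub>R G $ j)"

lemma linear_apply_rows: "linear (apply_rows A)"
  by (rule linearI)
    (simp_all add: apply_rows_def vec_eq_iff scaleR_sum_right sum.distrib algebra_simps)

lemma apply_rows_diag_minus:
  "apply_rows (diag \<beta> - c *\<^sub>R L) G $ i = \<beta> i *\<^sub>R G $ i - c *\<^sub>R apply_rows L G $ i"
proof -
  have "(\<Sum>j\<in>UNIV. diag \<beta> $ i $ j *\<^sub>R G $ j) = (\<Sum>j\<in>UNIV. if i = j then \<beta> i *\<^sub>R G $ j else 0)"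
    by (intro sum.cong refl) (simp add: diag_def)
  then show ?thesis
    by (simp add: apply_rows_def scaleR_sum_right sum_subtractf scaleR_diff_left)
qed

lemma inner_apply_rows:
  "G \<bullet> apply_rows A H = (\<Sum>i\<in>UNIV. \<Sum>j\<in>UNIV. A $ i $ j * (G $ i \<bullet> H $ j))"
  by (simp add: inner_vec_rows apply_rows_def inner_sum_right)

lemma inner_apply_rows_commute:
  assumes "transpose A = A"
  shows "G \<bullet> apply_rows A H = H \<bullet> apply_rows A G"
proof -
  have entry: "A $ i $ j = A $ j $ i" for i j
    using arg_cong[OF assms, of "\<lambda>B. B $ j $ i"] by (simp add: transpose_def)
  have "G \<bullet> apply_rows A H = (\<Sum>j\<in>UNIV. \<Sum>i\<in>UNIV. A $ i $ j * (G $ i \<bullet> H $ j))"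
    unfolding inner_apply_rows by (rule sum.swap)
  also have "\<dots> = (\<Sum>j\<in>UNIV. \<Sum>i\<in>UNIV. A $ j $ i * (H $ j \<bullet> G $ i))"
  proof (intro sum.cong refl)
    fix i j
    show "A $ i $ j * (G $ i \<bullet> H $ j) = A $ j $ i * (H $ j \<bullet> G $ i)"
      by (simp only: entry[of i j] inner_commute[of "G $ i" "H $ j"])
  qed
  finally show ?thesis by (simp only: inner_apply_rows)
qed

lemma inner_apply_rows_columns:
  fixes G :: "real^'p^'n"
  shows "G \<bullet> apply_rows A G = (\<Sum>d\<in>UNIV. column d G \<bullet> (A *v column d G))"
proof -
  have "G \<bullet> apply_rows A G
      = (\<Sum>i\<in>UNIV. \<Sum>j\<in>UNIV. \<Sum>d\<in>UNIV. G $ i $ d * (A $ i $ j * G $ j $ d))"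
    unfolding inner_apply_rows
    by (intro sum.cong refl) (simp add: inner_vec_def sum_distrib_left mult_ac)
  also have "\<dots> = (\<Sum>i\<in>UNIV. \<Sum>d\<in>UNIV. \<Sum>j\<in>UNIV. G $ i $ d * (A $ i $ j * G $ j $ d))"
    by (intro sum.cong refl sum.swap)
  also have "\<dots> = (\<Sum>d\<in>UNIV. \<Sum>i\<in>UNIV. \<Sum>j\<in>UNIV. G $ i $ d * (A $ i $ j * G $ j $ d))"
    by (rule sum.swap)
  also have "\<dots> = (\<Sum>d\<in>UNIV. column d G \<bullet> (A *v column d G))"
    by (simp add: inner_vec_def matrix_vector_mult_def column_def sum_distrib_left)
  finally show ?thesis .
qed

text \<open>Positivity passes from vectors to matrices because \<open>A\<close> acts on each column separately.\<close>

lemma psd_inner_apply_rows_nonneg: "psd A \<Longrightarrow> 0 \<le> G \<bullet> apply_rows A G"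
  unfolding inner_apply_rows_columns by (intro sum_nonneg) (simp add: psd_def)

text \<open>
  The last bound is Cauchy-Schwarz.  Inserting it into the expansion of \<open>0 \<le> u \<bullet> T u\<close> at
  \<open>u = v - (1 / K) *\<^sub>R T v\<close>, a gradient step of length \<open>1 / K\<close> for the quadratic form of \<open>T\<close>,
  gives the other one: the seminorm of \<open>T\<close> controls \<open>T v\<close> even if \<open>T\<close> is singular.
\<close>

lemma self_adjoint_nonneg_bounds:
  fixes T :: "'a::euclidean_space \<Rightarrow> 'a"
  assumes lin: "linear T" and sym: "\<And>v w. v \<bullet> T w = w \<bullet> T v" and nonneg: "\<And>v. 0 \<le> v \<bullet> T v"
  obtains K where "K > 0" "\<And>v. (norm (T v))\<^sup>2 \<le> K * (v \<bullet> T v)" "\<And>v. v \<bullet> T v \<le> K * (norm v)\<^sup>2"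
proof -
  obtain K where K: "K > 0" "\<And>v. norm (T v) \<le> K * norm v"
    using linear_bounded_pos[OF lin] by blast
  have upper: "v \<bullet> T v \<le> K * (norm v)\<^sup>2" for v
  proof -
    have "v \<bullet> T v \<le> norm v * norm (T v)" by (rule norm_cauchy_schwarz)
    also have "\<dots> \<le> norm v * (K * norm v)" by (intro mult_left_mono K) simp
    finally show ?thesis by (simp add: power2_eq_square mult_ac)
  qed
  have "(norm (T v))\<^sup>2 \<le> K * (v \<bullet> T v)" for v
  proof -
    define t where "t = 1 / K"
    have t: "t > 0" "t * K = 1" using K(1) by (simp_all add: t_def)
    have "0 \<le> (v - t *\<^sub>R T v) \<bullet> T (v - t *\<^sub>R T v)" by (rule nonneg)
    also have "\<dots> = v \<bullet> T v - t * (T v \<bullet> T v) - t * (v \<bullet> T (T v)) + t * t * (T v \<bullet> T (T v))"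
      by (simp add: linear_diff[OF lin] linear_scale[OF lin] inner_diff_left inner_diff_right
          algebra_simps)
    also have "\<dots> = v \<bullet> T v - 2 * t * (norm (T v))\<^sup>2 + t * t * (T v \<bullet> T (T v))"
      using sym[of v "T v"] by (simp add: power2_norm_eq_inner)
    also have "\<dots> \<le> v \<bullet> T v - 2 * t * (norm (T v))\<^sup>2 + t * t * (K * (norm (T v))\<^sup>2)"
      using t(1) by (intro add_left_mono mult_left_mono upper) simp
    also have "t * t * (K * (norm (T v))\<^sup>2) = t * (norm (T v))\<^sup>2"
      using t(2) by (metis mult.assoc mult_1 mult.left_commute)
    finally have "t * (norm (T v))\<^sup>2 \<le> v \<bullet> T v" by simp
    then have "K * (t * (norm (T v))\<^sup>2) \<le> K * (v \<bullet> T v)" using K(1) by simp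
    then show ?thesis using t(2) by (simp add: mult.assoc[symmetric] mult.commute[of K t])
  qed
  with K(1) upper that show thesis by blast
qed

section \<open>The factor U\<close>

lemma U_mult_Ut_mult_adjoint:
  fixes G :: "real^'p^'n"
  shows "G \<bullet> Ut_mult U q = (\<Sum>k<CARD('n) - 1. U_mult U G k \<bullet> q k)"
proof -
  have "G \<bullet> Ut_mult U q = (\<Sum>i\<in>UNIV. \<Sum>k<CARD('n) - 1. U k $ i * (G $ i \<bullet> q k))"
    by (simp add: inner_vec_rows Ut_mult_def inner_sum_right)
  also have "\<dots> = (\<Sum>k<CARD('n) - 1. \<Sum>i\<in>UNIV. U k $ i * (G $ i \<bullet> q k))"
    by (rule sum.swap)
  finally show ?thesis by (simp add: U_mult_def inner_sum_left)
qed

lemma Ut_mult_add: "Ut_mult U (\<lambda>k. a k + b k) = Ut_mult U a + Ut_mult U b"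
  by (simp add: Ut_mult_def vec_eq_iff sum.distrib algebra_simps)

lemma Ut_mult_diff: "Ut_mult U (\<lambda>k. a k - b k) = Ut_mult U a - Ut_mult U b"
  by (simp add: Ut_mult_def vec_eq_iff sum_subtractf algebra_simps)

lemma U_mult_diff: "U_mult U (G - H) k = U_mult U G k - U_mult U H k"
  by (simp add: U_mult_def sum_subtractf algebra_simps)

lemma Ut_mult_U_mult:
  fixes G :: "real^'p^'n"
  shows "Ut_mult U (U_mult U G) = apply_rows (gram U) G"
proof -
  have "(\<Sum>k<CARD('n) - 1. \<Sum>j\<in>UNIV. (U k $ i * U k $ j) *\<^sub>R G $ j)
      = (\<Sum>j\<in>UNIV. \<Sum>k<CARD('n) - 1. (U k $ i * U k $ j) *\<^sub>R G $ j)" for i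
    by (rule sum.swap)
  then show ?thesis
    by (simp add: Ut_mult_def U_mult_def apply_rows_def gram_def vec_eq_iff
        scaleR_sum_right scaleR_sum_left)
qed

text \<open>
  The rows \<open>U k\<close> are linearly independent, so they have a dual family \<open>W\<close>: the matrix with columns
  \<open>W l\<close> is a right inverse of \<open>U\<close>.
\<close>

lemma full_row_rank_dual:
  fixes U :: "nat \<Rightarrow> real^'n"
  assumes "full_row_rank U"
  obtains W where "\<And>k l. k < CARD('n) - 1 \<Longrightarrow> l < CARD('n) - 1 \<Longrightarrow>
    (\<Sum>i\<in>UNIV. W l $ i * U k $ i) = (if k = l then 1 else (0::real))"
proof -
  let ?K = "{..<CARD('n) - 1}"
  have "dim (U ` ?K) = card ?K" using assms by (simp add: full_row_rank_def)
  moreover have "dim (U ` ?K) \<le> card (U ` ?K)"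
    by (rule dim_le_card) (auto simp: span_base)
  moreover have "card (U ` ?K) \<le> card ?K" by (rule card_image_le) simp
  ultimately have card: "card (U ` ?K) = card ?K" "dim (U ` ?K) = card (U ` ?K)" by auto
  \<comment> \<open>the rank counts the set of rows, so distinctness of the rows has to be extracted too\<close>
  have inj: "inj_on U ?K" by (rule eq_card_imp_inj_on) (use card in auto)
  have ind: "independent (U ` ?K)"
    by (rule card_le_dim_spanning[of _ "U ` ?K"]) (use card in \<open>auto simp: span_base\<close>)
  have "\<exists>w. \<forall>k<CARD('n) - 1. (\<Sum>i\<in>UNIV. w $ i * U k $ i) = (if k = l then 1 else 0)"
    if l: "l < CARD('n) - 1" for l
  proof -
    obtain g :: "real^'n \<Rightarrow> real" where g: "linear g"
        "\<forall>v\<in>U ` ?K. g v = (if v = U l then 1 else 0)"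
      using linear_independent_extend[OF ind, of "\<lambda>v. if v = U l then 1 else (0::real)"] by blast
    have "(\<Sum>i\<in>UNIV. adjoint g 1 $ i * U k $ i) = (if k = l then 1 else 0)"
      if "k < CARD('n) - 1" for k
    proof -
      have "(\<Sum>i\<in>UNIV. adjoint g 1 $ i * U k $ i) = g (U k)"
        using adjoint_works[OF g(1), of "U k" 1] by (simp add: inner_vec_def mult.commute)
      then show ?thesis
        using g(2) that l inj_on_eq_iff[OF inj, of k l] by auto
    qed
    then show ?thesis by blast
  qed
  then have "\<forall>l. \<exists>w. l < CARD('n) - 1 \<longrightarrow>
      (\<forall>k<CARD('n) - 1. (\<Sum>i\<in>UNIV. w $ i * U k $ i) = (if k = l then 1 else 0))"
    by blast
  from choice[OF this] that show thesis by blast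
qed

text \<open>Pairing $U^\top q$ with the dual family recovers each row of \<open>q\<close>, at bounded cost.\<close>

lemma Ut_mult_bounded_below:
  fixes U :: "nat \<Rightarrow> real^'n"
  assumes "full_row_rank U"
  obtains S where "S \<ge> 0"
    "\<And>q::nat \<Rightarrow> real^'p. (\<Sum>k<CARD('n) - 1. (norm (q k))\<^sup>2) \<le> S * (norm (Ut_mult U q))\<^sup>2"
proof -
  obtain W where W: "\<And>k l. k < CARD('n) - 1 \<Longrightarrow> l < CARD('n) - 1 \<Longrightarrow>
      (\<Sum>i\<in>UNIV. W l $ i * U k $ i) = (if k = l then 1 else (0::real))"
    using full_row_rank_dual[OF assms] by blast
  define a where "a l = (\<Sum>i\<in>UNIV. \<bar>W l $ i\<bar>)" for l
  have "(norm (q l))\<^sup>2 \<le> (a l)\<^sup>2 * (norm (Ut_mult U q))\<^sup>2"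
    if l: "l < CARD('n) - 1" for q :: "nat \<Rightarrow> real^'p" and l
  proof -
    have "(\<Sum>i\<in>UNIV. W l $ i *\<^sub>R Ut_mult U q $ i)
        = (\<Sum>i\<in>UNIV. \<Sum>k<CARD('n) - 1. (W l $ i * U k $ i) *\<^sub>R q k)"
      by (simp add: Ut_mult_def scaleR_sum_right)
    also have "\<dots> = (\<Sum>k<CARD('n) - 1. (\<Sum>i\<in>UNIV. W l $ i * U k $ i) *\<^sub>R q k)"
      by (subst sum.swap) (simp add: scaleR_sum_left)
    also have "\<dots> = (\<Sum>k<CARD('n) - 1. if k = l then q k else 0)"
      by (intro sum.cong refl) (use W l in auto)
    also have "\<dots> = q l" using l by simp
    finally have "norm (q l) = norm (\<Sum>i\<in>UNIV. W l $ i *\<^sub>R Ut_mult U q $ i)" by simp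
    also have "\<dots> \<le> (\<Sum>i\<in>UNIV. \<bar>W l $ i\<bar> * norm (Ut_mult U q))"
      by (intro sum_norm_le) (simp add: Finite_Cartesian_Product.norm_nth_le mult_left_mono)
    also have "\<dots> = a l * norm (Ut_mult U q)" by (simp add: a_def sum_distrib_right)
    finally show ?thesis by (metis power_mono norm_ge_zero power_mult_distrib)
  qed
  then have "(\<Sum>k<CARD('n) - 1. (norm (q k))\<^sup>2)
      \<le> (\<Sum>k<CARD('n) - 1. (a k)\<^sup>2) * (norm (Ut_mult U q))\<^sup>2" for q :: "nat \<Rightarrow> real^'p"
    unfolding sum_distrib_right by (intro sum_mono) auto
  then show thesis using that[of "\<Sum>k<CARD('n) - 1. (a k)\<^sup>2"] by (simp add: sum_nonneg)
qed

text \<open>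
  This follows by perturbing the optimum along $U_k^\top w$, where \<open>w\<close> is the \<open>k\<close>-th row of
  $U \nabla f(x^*)$: the direction is feasible because \<open>U k\<close> is orthogonal to the constant vector, and
  the derivative along it is $\|w\|^2$.
\<close>

lemma U_mult_optimal_gradient:
  fixes f :: "'n::finite \<Rightarrow> real^'p \<Rightarrow> real"
  assumes diff: "\<And>i v. f i differentiable (at v)"
    and opt: "optimal_allocation f r xs"
    and ones: "(\<chi> i. 1) \<in> null_space U"
    and k: "k < CARD('n) - 1"
  shows "U_mult U (Grad f xs) k = 0"
proof -
  let ?w = "U_mult U (Grad f xs) k"
  let ?D = "\<chi> i. U k $ i *\<^sub>R ?w"
  have "(\<Sum>i\<in>UNIV. U k $ i) = 0"
    using ones k by (simp add: null_space_def inner_vec_def)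
  then have "(\<Sum>i\<in>UNIV. ?D $ i) = 0" by (simp add: scaleR_sum_left[symmetric])
  then have "?D \<bullet> Grad f xs = 0" using optimal_allocation_orthogonal[OF diff opt] by blast
  moreover have "?D \<bullet> Grad f xs = ?w \<bullet> ?w"
    by (simp add: inner_vec_rows U_mult_def[of U _ k] inner_sum_right)
  ultimately show ?thesis by simp
qed

section \<open>The seminorm as an energy\<close>

text \<open>
  The squared $M$-seminorm in terms of its two blocks.  It is separated from \<open>M_norm\<close> so that
  the quadratic form can be manipulated without square roots and stacked indices.
\<close>

definition energy :: "real \<Rightarrow> real^'n^'n \<Rightarrow> (nat \<Rightarrow> real^'p) \<Rightarrow> real^'p^'n \<Rightarrow> real" where
  "energy c P e G = c * (\<Sum>k<CARD('n) - 1. (norm (e k))\<^sup>2) + G \<bullet> apply_rows P G"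

lemma energy_nonneg: "psd P \<Longrightarrow> 0 \<le> c \<Longrightarrow> 0 \<le> energy c P e G"
  by (simp add: energy_def psd_inner_apply_rows_nonneg sum_nonneg)

lemma M_norm_squared:
  fixes L :: "real^'n^'n" and e :: "nat \<Rightarrow> real^'p"
  assumes psd: "psd (diag \<beta> - c *\<^sub>R L)" and c: "0 \<le> c"
  shows "(M_norm (M_mat L \<beta> c) (\<lambda>a. stack e G a - stack e' G' a))\<^sup>2
      = energy c (diag \<beta> - c *\<^sub>R L) (\<lambda>k. e k - e' k) (G - G')"
proof -
  let ?P = "diag \<beta> - c *\<^sub>R L"
  let ?K = "{..<CARD('n) - 1}"
  let ?I = "?K <+> (UNIV :: 'n set)"
  let ?A = "\<lambda>a. stack e G a - stack e' G' a"
  have "trace ((\<chi> d f. \<Sum>a\<in>?I. \<Sum>b\<in>?I. ?A a $ d * M_mat L \<beta> c a b * ?A b $ f) :: real^'p^'p)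
      = (\<Sum>d\<in>UNIV. \<Sum>a\<in>?I. \<Sum>b\<in>?I. ?A a $ d * M_mat L \<beta> c a b * ?A b $ d)"
    by (simp add: trace_def)
  also have "\<dots> = (\<Sum>a\<in>?I. \<Sum>d\<in>UNIV. \<Sum>b\<in>?I. ?A a $ d * M_mat L \<beta> c a b * ?A b $ d)"
    by (rule sum.swap)
  also have "\<dots> = (\<Sum>a\<in>?I. \<Sum>b\<in>?I. \<Sum>d\<in>UNIV. ?A a $ d * M_mat L \<beta> c a b * ?A b $ d)"
    by (intro sum.cong refl sum.swap)
  also have "\<dots> = (\<Sum>a\<in>?I. \<Sum>b\<in>?I. M_mat L \<beta> c a b * (?A a \<bullet> ?A b))"
    by (intro sum.cong refl) (simp add: inner_vec_def sum_distrib_left mult_ac)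
  also have "\<dots> = (\<Sum>k\<in>?K. \<Sum>l\<in>?K. if k = l then c * ((e k - e' k) \<bullet> (e l - e' l)) else 0)
      + (\<Sum>i\<in>UNIV. \<Sum>j\<in>UNIV. ?P $ i $ j * ((G - G') $ i \<bullet> (G - G') $ j))"
    by (simp add: sum.Plus M_mat_def stack_def if_distrib[of "\<lambda>x. x * _"] cong: if_cong)
  also have "\<dots> = energy c ?P (\<lambda>k. e k - e' k) (G - G')"
    by (simp add: energy_def inner_apply_rows power2_norm_eq_inner sum_distrib_left)
  finally show ?thesis
    unfolding M_norm_def Let_def
    using energy_nonneg[OF psd c, of "\<lambda>k. e k - e' k" "G - G'"] by simp
qed

text \<open>
  Here \<open>e\<close>, \<open>g\<close>, \<open>w\<close> are the errors in \<open>q\<close>, the gradient and \<open>x\<close> after a step, and \<open>d\<close>, \<open>h\<close> are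
  the old values of \<open>q\<close> and the gradient minus the new ones.  Expanding the square leaves the cross
  terms $c \langle e, d \rangle + \langle g, P h \rangle$; since \<open>U\<close> and $U^\top$ are adjoint, the
  dual parts cancel and only $\langle w, g \rangle$ remains.
\<close>

lemma energy_descent:
  fixes e d :: "nat \<Rightarrow> real^'p" and g h w :: "real^'p^'n"
  assumes sym: "transpose P = P"
    and primal: "w + c *\<^sub>R Ut_mult U e = apply_rows P h"
    and dual: "\<And>k. k < CARD('n) - 1 \<Longrightarrow> U_mult U g k = - d k"
  shows "energy c P (\<lambda>k. e k + d k) (g + h) = energy c P e g + energy c P d h + 2 * (w \<bullet> g)"
proof -
  have "g \<bullet> Ut_mult U e = - (\<Sum>k<CARD('n) - 1. e k \<bullet> d k)"
    unfolding U_mult_Ut_mult_adjoint sum_negf[symmetric]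
    by (intro sum.cong refl) (simp add: dual inner_commute)
  then have cross: "g \<bullet> apply_rows P h = w \<bullet> g - c * (\<Sum>k<CARD('n) - 1. e k \<bullet> d k)"
    unfolding primal[symmetric] by (simp add: inner_simps inner_commute)
  have "(\<Sum>k<CARD('n) - 1. (norm (e k + d k))\<^sup>2)
      = (\<Sum>k<CARD('n) - 1. (norm (e k))\<^sup>2) + (\<Sum>k<CARD('n) - 1. (norm (d k))\<^sup>2)
        + 2 * (\<Sum>k<CARD('n) - 1. e k \<bullet> d k)"
    unfolding sum_distrib_left sum.distrib[symmetric]
    by (intro sum.cong refl) (simp add: power2_norm_eq_inner inner_simps inner_commute)
  moreover have "(g + h) \<bullet> apply_rows P (g + h)
      = g \<bullet> apply_rows P g + h \<bullet> apply_rows P h + 2 * (g \<bullet> apply_rows P h)"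
    using inner_apply_rows_commute[OF sym, of h g]
    by (simp add: linear_add[OF linear_apply_rows] inner_simps)
  ultimately show ?thesis
    unfolding energy_def cross by (simp add: algebra_simps)
qed

text \<open>
  The variables have the meaning of the preceding lemma, whose two gains form the right-hand side.
  The constant is independent of the errors, hence uniform in the iteration.
\<close>

lemma energy_error_bound:
  fixes U :: "nat \<Rightarrow> real^'n"
  assumes psd: "psd P" and rank: "full_row_rank U" and c: "c > 0" and \<mu>: "\<mu> > 0"
  obtains C where "C > 0"
    "\<And>(e :: nat \<Rightarrow> real^'p) d (g::real^'p^'n) h w.
      w + c *\<^sub>R Ut_mult U e = apply_rows P h \<Longrightarrow>
      norm g \<le> K * norm w \<Longrightarrow> \<mu> * (norm w)\<^sup>2 \<le> w \<bullet> g \<Longrightarrow>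
      energy c P e g \<le> C * (energy c P d h + 2 * (w \<bullet> g))"
proof -
  have sym: "transpose P = P" using psd by (simp add: psd_def)
  obtain S where S: "S \<ge> 0"
    "\<And>q::nat \<Rightarrow> real^'p. (\<Sum>k<CARD('n) - 1. (norm (q k))\<^sup>2) \<le> S * (norm (Ut_mult U q))\<^sup>2"
    using Ut_mult_bounded_below[OF rank] by blast
  obtain \<Lambda> where \<Lambda>: "\<Lambda> > 0"
    "\<And>v::real^'p^'n. (norm (apply_rows P v))\<^sup>2 \<le> \<Lambda> * (v \<bullet> apply_rows P v)"
    "\<And>v::real^'p^'n. v \<bullet> apply_rows P v \<le> \<Lambda> * (norm v)\<^sup>2"
    using self_adjoint_nonneg_bounds[OF linear_apply_rows inner_apply_rows_commute[OF sym]
        psd_inner_apply_rows_nonneg[OF psd]] by blast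
  define C1 where "C1 = 2 * S * \<Lambda> / c"
  define C2 where "C2 = 2 * S / c + \<Lambda> * K\<^sup>2"
  have C12: "C1 \<ge> 0" "C2 \<ge> 0" using S(1) \<Lambda>(1) c by (auto simp: C1_def C2_def)
  define C where "C = C1 + C2 / (2 * \<mu>) + 1"
  have "C > 0" using C12 \<mu> by (simp add: C_def add_nonneg_pos)
  moreover have "energy c P e g \<le> C * (energy c P d h + 2 * (w \<bullet> g))"
    if primal: "w + c *\<^sub>R Ut_mult U e = apply_rows P h"
      and lip: "norm g \<le> K * norm w" and conv: "\<mu> * (norm w)\<^sup>2 \<le> w \<bullet> g"
    for e d :: "nat \<Rightarrow> real^'p" and g h w :: "real^'p^'n"
  proof -
    let ?Eh = "h \<bullet> apply_rows P h"
    have Ut: "c *\<^sub>R Ut_mult U e = apply_rows P h - w" using primal by (simp add: algebra_simps)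
    have "c\<^sup>2 * (norm (Ut_mult U e))\<^sup>2 = (norm (apply_rows P h - w))\<^sup>2"
      unfolding Ut[symmetric] by (simp add: power_mult_distrib)
    also have "\<dots> \<le> 2 * (norm (apply_rows P h))\<^sup>2 + 2 * (norm w)\<^sup>2"
    proof -
      have "0 \<le> (norm (apply_rows P h + w))\<^sup>2" by simp
      then show ?thesis by (simp add: power2_norm_eq_inner inner_simps inner_commute)
    qed
    also have "\<dots> \<le> 2 * (\<Lambda> * ?Eh) + 2 * (norm w)\<^sup>2" using \<Lambda>(2)[of h] by simp
    finally have Ut_bound: "c\<^sup>2 * (norm (Ut_mult U e))\<^sup>2 \<le> 2 * (\<Lambda> * ?Eh) + 2 * (norm w)\<^sup>2" .
    have "c * (\<Sum>k<CARD('n) - 1. (norm (e k))\<^sup>2) \<le> c * (S * (norm (Ut_mult U e))\<^sup>2)"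
      using S(2)[of e] c by simp
    also have "\<dots> = S / c * (c\<^sup>2 * (norm (Ut_mult U e))\<^sup>2)"
      using c by (simp add: power2_eq_square)
    also have "\<dots> \<le> S / c * (2 * (\<Lambda> * ?Eh) + 2 * (norm w)\<^sup>2)"
      using S(1) c by (intro mult_left_mono Ut_bound) auto
    finally have e_bound: "c * (\<Sum>k<CARD('n) - 1. (norm (e k))\<^sup>2)
        \<le> C1 * ?Eh + 2 * S / c * (norm w)\<^sup>2"
      by (simp add: C1_def algebra_simps)
    have "(norm g)\<^sup>2 \<le> K\<^sup>2 * (norm w)\<^sup>2"
      using lip by (metis power_mono norm_ge_zero power_mult_distrib)
    then have "\<Lambda> * (norm g)\<^sup>2 \<le> \<Lambda> * (K\<^sup>2 * (norm w)\<^sup>2)" using \<Lambda>(1) by simp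
    then have "g \<bullet> apply_rows P g \<le> \<Lambda> * K\<^sup>2 * (norm w)\<^sup>2" using \<Lambda>(3)[of g] by (simp add: mult.assoc)
    with e_bound have "energy c P e g \<le> C1 * ?Eh + C2 * (norm w)\<^sup>2"
      by (simp add: energy_def C2_def algebra_simps)
    also have "\<dots> \<le> C1 * energy c P d h + C2 / (2 * \<mu>) * (2 * (w \<bullet> g))"
    proof (rule add_mono)
      show "C1 * ?Eh \<le> C1 * energy c P d h"
        using C12(1) c by (intro mult_left_mono) (simp_all add: energy_def sum_nonneg)
      have "C2 * (norm w)\<^sup>2 = C2 / \<mu> * (\<mu> * (norm w)\<^sup>2)" using \<mu> by simp
      also have "\<dots> \<le> C2 / \<mu> * (w \<bullet> g)" using C12(2) \<mu> by (intro mult_left_mono conv) auto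
      finally show "C2 * (norm w)\<^sup>2 \<le> C2 / (2 * \<mu>) * (2 * (w \<bullet> g))" by simp
    qed
    also have "\<dots> \<le> C * energy c P d h + C * (2 * (w \<bullet> g))"
    proof (intro add_mono mult_right_mono)
      show "0 \<le> energy c P d h" using psd c by (simp add: energy_nonneg)
      have "0 \<le> \<mu> * (norm w)\<^sup>2" using \<mu> by simp
      with conv show "0 \<le> 2 * (w \<bullet> g)" by linarith
    qed (use C12 \<mu> in \<open>auto simp: C_def\<close>)
    finally show ?thesis by (simp add: algebra_simps)
  qed
  ultimately show thesis using that by blast
qed

section \<open>The iteration in terms of gradients\<close>

lemma mirror_P_EXTRA_s_eq_Grad:
  assumes diff: "\<And>i v. f i differentiable (at v)" and \<beta>: "\<And>i. \<beta> i > 0"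
    and alg: "mirror_P_EXTRA f r E L \<beta> c x s y"
  shows "s k = Grad f (x k)"
proof (cases k)
  case 0
  then show ?thesis using alg by (simp add: mirror_P_EXTRA_def Grad_def vec_eq_iff)
next
  case (Suc k)
  have "s (Suc k) $ i = gradient (f i) (x (Suc k) $ i)" for i
  proof -
    define w where "w = - r $ i + (2 * c) *\<^sub>R y (Suc k) $ i - c *\<^sub>R y k $ i"
    have w: "v - r $ i + (2 * c) *\<^sub>R y (Suc k) $ i - c *\<^sub>R y k $ i = v + w" for v
      by (simp add: w_def)
    have "is_arg_min (\<lambda>v. f i v - s k $ i \<bullet> v + 1 / (2 * \<beta> i) * (norm (v + w))\<^sup>2)
        (\<lambda>_. True) (x (Suc k) $ i)"
      using alg unfolding mirror_P_EXTRA_def w[symmetric] by blast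
    moreover have "s (Suc k) $ i = s k $ i - (1 / \<beta> i) *\<^sub>R (x (Suc k) $ i + w)"
      using alg unfolding mirror_P_EXTRA_def w[symmetric] by blast
    ultimately show ?thesis
      using gradient_at_regularised_min[where f = "f i" and b = "\<beta> i", OF diff \<beta>] by simp
  qed
  then show ?thesis using Suc by (simp add: Grad_def vec_eq_iff)
qed

lemma mirror_P_EXTRA_y_Suc:
  assumes "compatible E L" and alg: "mirror_P_EXTRA f r E L \<beta> c x s y"
  shows "y (Suc k) = y k + apply_rows L (s k)"
proof -
  have "(\<Sum>j\<in>neighbors E i \<union> {i}. L $ i $ j *\<^sub>R s k $ j) = (\<Sum>j\<in>UNIV. L $ i $ j *\<^sub>R s k $ j)" for i
    by (rule sum.mono_neutral_left)
      (use assms(1) in \<open>auto simp: compatible_def neighbors_def\<close>)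
  then show ?thesis
    using alg by (simp add: mirror_P_EXTRA_def apply_rows_def vec_eq_iff)
qed

lemma mirror_P_EXTRA_y_eq_Ut_q:
  assumes diff: "\<And>i v. f i differentiable (at v)" and \<beta>: "\<And>i. \<beta> i > 0"
    and comp: "compatible E (gram U)" and alg: "mirror_P_EXTRA f r E (gram U) \<beta> c x s y"
  shows "y (Suc k) = Ut_mult U (q_seq f U x k)"
proof (induction k)
  case 0
  have "y 0 = 0" using alg by (simp add: mirror_P_EXTRA_def vec_eq_iff)
  then show ?case
    using mirror_P_EXTRA_y_Suc[OF comp alg, of 0] mirror_P_EXTRA_s_eq_Grad[OF diff \<beta> alg]
    by (simp add: Ut_mult_U_mult)
next
  case (Suc k)
  then show ?case
    using mirror_P_EXTRA_y_Suc[OF comp alg, of "Suc k"] mirror_P_EXTRA_s_eq_Grad[OF diff \<beta> alg]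
    by (simp add: Ut_mult_add Ut_mult_U_mult)
qed

text \<open>
  Since $y^{k-1} = y^k - L g^k$ and $y^{k+1} = y^k + L g^{k+1}$, the extrapolated dual variable
  $2y^k - y^{k-1}$ is $y^{k+1} + L (g^k - g^{k+1})$.  This replaces the explicit dual step by
  an implicit one and turns the weight \<open>B\<close> into $B - cL$.
\<close>

lemma mirror_P_EXTRA_optimality_residual:
  assumes diff: "\<And>i v. f i differentiable (at v)" and \<beta>: "\<And>i. \<beta> i > 0"
    and comp: "compatible E (gram U)" and alg: "mirror_P_EXTRA f r E (gram U) \<beta> c x s y"
  shows "x (Suc k) - r + c *\<^sub>R Ut_mult U (q_seq f U x (Suc k))
      = apply_rows (diag \<beta> - c *\<^sub>R gram U) (Grad f (x k) - Grad f (x (Suc k)))"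
proof -
  note s = mirror_P_EXTRA_s_eq_Grad[OF diff \<beta> alg, symmetric]
  note lin = linear_diff[OF linear_apply_rows]
  have step: "x (Suc k) $ i - r $ i + (2 * c) *\<^sub>R y (Suc k) $ i - c *\<^sub>R y k $ i
      = \<beta> i *\<^sub>R (s k $ i - s (Suc k) $ i)" for i
  proof -
    have "s (Suc k) $ i = s k $ i - (1 / \<beta> i)
        *\<^sub>R (x (Suc k) $ i - r $ i + (2 * c) *\<^sub>R y (Suc k) $ i - c *\<^sub>R y k $ i)"
      using alg by (simp add: mirror_P_EXTRA_def)
    then show ?thesis using \<beta>[of i] by simp
  qed
  have y1: "y (Suc k) $ i = y k $ i + apply_rows (gram U) (s k) $ i"
    and y2: "y (Suc (Suc k)) $ i = y (Suc k) $ i + apply_rows (gram U) (s (Suc k)) $ i" for i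
    using mirror_P_EXTRA_y_Suc[OF comp alg] by simp_all
  have "x (Suc k) $ i - r $ i + c *\<^sub>R y (Suc (Suc k)) $ i
      = \<beta> i *\<^sub>R (s k $ i - s (Suc k) $ i)
        - c *\<^sub>R (apply_rows (gram U) (s k) $ i - apply_rows (gram U) (s (Suc k)) $ i)" for i
  proof -
    have "(2 * c) *\<^sub>R v = c *\<^sub>R v + c *\<^sub>R v" for v :: "real^'b"
      by (metis mult_2 scaleR_left_distrib)
    then show ?thesis
      unfolding step[symmetric] y2 using y1[of i] by (simp add: algebra_simps)
  qed
  then show ?thesis
    unfolding mirror_P_EXTRA_y_eq_Ut_q[OF diff \<beta> comp alg, symmetric] s
    by (simp add: vec_eq_iff apply_rows_diag_minus lin algebra_simps)
qed

section \<open>Linear convergence\<close>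

lemma Grad_strongly_monotone:
  fixes f :: "'n::finite \<Rightarrow> real^'p \<Rightarrow> real"
  assumes "\<And>i. \<mu> i > 0" and "\<And>i. strongly_convex (\<mu> i) (f i)"
  obtains m where "m > 0" "\<And>u v. m * (norm (u - v))\<^sup>2 \<le> (u - v) \<bullet> (Grad f u - Grad f v)"
proof -
  define m where "m = Min (range \<mu>)"
  have "m > 0" using assms(1) by (simp add: m_def)
  moreover have "m * (norm (u - v))\<^sup>2 \<le> (u - v) \<bullet> (Grad f u - Grad f v)" for u v
  proof -
    have "m * (norm (u $ i - v $ i))\<^sup>2
        \<le> (u $ i - v $ i) \<bullet> (gradient (f i) (u $ i) - gradient (f i) (v $ i))" for i
    proof -
      have "m * (norm (u $ i - v $ i))\<^sup>2 \<le> \<mu> i * (norm (u $ i - v $ i))\<^sup>2"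
        by (intro mult_right_mono) (auto simp: m_def)
      also have "\<dots> \<le> (u $ i - v $ i) \<bullet> (gradient (f i) (u $ i) - gradient (f i) (v $ i))"
        using assms(2)[of i] by (simp add: strongly_convex_def inner_commute)
      finally show ?thesis .
    qed
    then show ?thesis
      unfolding power2_norm_eq_inner inner_vec_rows sum_distrib_left
      by (intro sum_mono) (simp add: Grad_def)
  qed
  ultimately show thesis using that by blast
qed

lemma Grad_Lipschitz:
  fixes f :: "'n::finite \<Rightarrow> real^'p \<Rightarrow> real"
  assumes "\<And>i. (Lip i)-lipschitz_on UNIV (gradient (f i))"
  shows "norm (Grad f u - Grad f v) \<le> (\<Sum>i\<in>UNIV. Lip i) * norm (u - v)"
proof -
  have "norm (Grad f u - Grad f v) \<le> (\<Sum>i\<in>UNIV. norm ((Grad f u - Grad f v) $ i))"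
    unfolding norm_vec_def by (rule L2_set_le_sum) simp
  also have "\<dots> \<le> (\<Sum>i\<in>UNIV. Lip i * norm (u - v))"
  proof (rule sum_mono)
    fix i
    have "norm ((Grad f u - Grad f v) $ i) \<le> Lip i * norm ((u - v) $ i)"
      using lipschitz_onD[OF assms[of i], of "u $ i" "v $ i"] by (simp add: Grad_def dist_norm)
    also have "\<dots> \<le> Lip i * norm (u - v)"
      using lipschitz_on_nonneg[OF assms[of i]]
      by (intro mult_left_mono Finite_Cartesian_Product.norm_nth_le)
    finally show "norm ((Grad f u - Grad f v) $ i) \<le> Lip i * norm (u - v)" .
  qed
  finally show ?thesis by (simp add: sum_distrib_right)
qed

lemma tendsto_of_power_bound:
  fixes x :: "nat \<Rightarrow> 'a::real_normed_vector"
  assumes \<rho>: "0 \<le> \<rho>" "\<rho> < 1" and bound: "\<And>k. (norm (x k - l))\<^sup>2 \<le> C * \<rho> ^ k"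
  shows "x \<longlonglongrightarrow> l"
proof -
  have "(\<lambda>k. C * \<rho> ^ k) \<longlonglongrightarrow> 0"
    using \<rho> by (auto intro!: tendsto_eq_intros LIMSEQ_realpow_zero)
  then have "(\<lambda>k. (norm (x k - l))\<^sup>2) \<longlonglongrightarrow> 0"
    by (rule tendsto_sandwich[rotated 3, where f = "\<lambda>_. 0"]) (use bound in auto)
  then have "(\<lambda>k. norm (x k - l)) \<longlonglongrightarrow> 0"
    using tendsto_real_sqrt by fastforce
  then show ?thesis
    by (simp add: LIM_zero_cancel tendsto_norm_zero_iff)
qed

theorem theorem3:
  fixes f :: "'n::finite \<Rightarrow> real^'p \<Rightarrow> real"
    and r :: "real^'p^'n"
    and E :: "'n set set"
    and L :: "real^'n^'n"
    and U :: "nat \<Rightarrow> real^'n"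
    and Lip \<mu> \<beta> :: "'n \<Rightarrow> real"
    and c :: real
    and x s y :: "nat \<Rightarrow> real^'p^'n"
    and xs :: "real^'p^'n"
    and qs :: "nat \<Rightarrow> real^'p"
  defines "z \<equiv> \<lambda>k. stack (q_seq f U x k) (Grad f (x k))"
    and "zs \<equiv> stack qs (Grad f xs)"
    and "M \<equiv> M_mat L \<beta> c"
  assumes "simple_graph E" and "connected_graph E"
    and "compatible E L"
    and "L = gram U" and "full_row_rank U" and "null_space U = {\<chi> i. a | a. True}"
    and "\<And>i v. f i differentiable (at v)"
    and "\<And>i. (Lip i)-lipschitz_on UNIV (gradient (f i))"
    and "\<And>i. \<mu> i > 0" and "\<And>i. strongly_convex (\<mu> i) (f i)"
    and "\<And>i. \<beta> i > 0" and "c > 0"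
    and "psd (diag \<beta> - c *\<^sub>R L)"
    and "mirror_P_EXTRA f r E L \<beta> c x s y"
    and "optimal_allocation f r xs"
    and "xs - r + c *\<^sub>R Ut_mult U qs = 0"
  shows "\<exists>\<delta>>0.
      (\<forall>k. (M_norm M (\<lambda>a. z (Suc k) a - zs a))\<^sup>2
            \<le> 1 / (1 + \<delta>) * (M_norm M (\<lambda>a. z k a - zs a))\<^sup>2) \<and>
      (\<lambda>k. M_norm M (\<lambda>a. z k a - zs a)) \<longlonglongrightarrow> 0 \<and>
      x \<longlonglongrightarrow> xs \<and>
      (\<lambda>k. (norm (x k - xs))\<^sup>2) \<in> O(\<lambda>k. (1 / (1 + \<delta>)) ^ k)"
proof -
  let ?P = "diag \<beta> - c *\<^sub>R L"
  let ?q = "q_seq f U x"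
  let ?g = "\<lambda>k. Grad f (x k)"
  let ?gs = "Grad f xs"
  have diff: "\<And>i v. f i differentiable (at v)" and \<beta>: "\<And>i. \<beta> i > 0" and c: "c > 0"
    and psd: "psd ?P" and opt: "optimal_allocation f r xs"
    and L: "L = gram U" and rank: "full_row_rank U"
    by fact+
  have sym: "transpose ?P = ?P" using psd by (simp add: psd_def)
  have comp: "compatible E (gram U)" and alg: "mirror_P_EXTRA f r E (gram U) \<beta> c x s y"
    using \<open>compatible E L\<close> \<open>mirror_P_EXTRA f r E L \<beta> c x s y\<close> L by simp_all
  define K where "K = (\<Sum>i\<in>UNIV. Lip i)"
  have lip: "norm (Grad f u - Grad f v) \<le> K * norm (u - v)" for u v
    unfolding K_def by (rule Grad_Lipschitz) fact
  obtain m where m: "m > 0"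
    "\<And>u v. m * (norm (u - v))\<^sup>2 \<le> (u - v) \<bullet> (Grad f u - Grad f v)"
    using Grad_strongly_monotone[of \<mu> f] \<open>\<And>i. \<mu> i > 0\<close> \<open>\<And>i. strongly_convex (\<mu> i) (f i)\<close> by blast
  have ones: "(\<chi> i. 1) \<in> null_space U"
    using \<open>null_space U = {\<chi> i. a | a. True}\<close> by auto
  define V where "V k = energy c ?P (\<lambda>l. ?q k l - qs l) (?g k - ?gs)" for k
  define Q where "Q k = energy c ?P (\<lambda>l. ?q k l - ?q (Suc k) l) (?g k - ?g (Suc k))" for k
  define w where "w k = x k - xs" for k
  have V_eq: "(M_norm M (\<lambda>a. z k a - zs a))\<^sup>2 = V k" for k
    unfolding M_def z_def zs_def V_def using psd c by (intro M_norm_squared) auto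
  have V_nonneg: "0 \<le> V k" and Q_nonneg: "0 \<le> Q k" for k
    unfolding V_def Q_def using psd c by (auto intro: energy_nonneg)
  have primal: "w (Suc k) + c *\<^sub>R Ut_mult U (\<lambda>l. ?q (Suc k) l - qs l)
      = apply_rows ?P (?g k - ?g (Suc k))" for k
    using mirror_P_EXTRA_optimality_residual[OF diff \<beta> comp alg, of k]
      \<open>xs - r + c *\<^sub>R Ut_mult U qs = 0\<close>
    unfolding L w_def Ut_mult_diff by (simp add: algebra_simps)
  have dual: "U_mult U (?g (Suc k) - ?gs) l = - (?q k l - ?q (Suc k) l)"
    if "l < CARD('n) - 1" for k l
    using U_mult_optimal_gradient[OF diff opt ones that] by (simp add: U_mult_diff)
  have descent: "V k = V (Suc k) + Q k + 2 * (w (Suc k) \<bullet> (?g (Suc k) - ?gs))" for k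
    using energy_descent[OF sym primal dual, of k k] unfolding V_def Q_def by simp
  obtain C where C: "C > 0"
    "\<And>(e :: nat \<Rightarrow> real^'p) d (g::real^'p^'n) h w.
      w + c *\<^sub>R Ut_mult U e = apply_rows ?P h \<Longrightarrow>
      norm g \<le> K * norm w \<Longrightarrow> m * (norm w)\<^sup>2 \<le> w \<bullet> g \<Longrightarrow>
      energy c ?P e g \<le> C * (energy c ?P d h + 2 * (w \<bullet> g))"
    using energy_error_bound[OF psd rank c m(1), where K = K] by blast
  define \<delta> where "\<delta> = 1 / C"
  define \<rho> where "\<rho> = 1 / (1 + \<delta>)"
  have \<delta>: "\<delta> > 0" using C(1) by (simp add: \<delta>_def)
  have \<rho>: "0 < \<rho>" "\<rho> < 1" using \<delta> by (auto simp: \<rho>_def)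
  have contraction: "V (Suc k) \<le> \<rho> * V k" for k
  proof -
    have "V (Suc k) \<le> C * (Q k + 2 * (w (Suc k) \<bullet> (?g (Suc k) - ?gs)))"
      unfolding V_def Q_def
      by (rule C(2)[OF primal]) (use lip m(2) in \<open>auto simp: w_def\<close>)
    then have "\<delta> * V (Suc k) \<le> Q k + 2 * (w (Suc k) \<bullet> (?g (Suc k) - ?gs))"
      using C(1) by (simp add: \<delta>_def field_simps)
    then have "(1 + \<delta>) * V (Suc k) \<le> V k" using descent[of k] by (simp add: algebra_simps)
    then show ?thesis using \<delta> by (simp add: \<rho>_def field_simps)
  qed
  have V_power: "V k \<le> V 0 * \<rho> ^ k" for k
  proof (induction k)
    case (Suc k)
    have "\<rho> * V k \<le> \<rho> * (V 0 * \<rho> ^ k)" using Suc \<rho> by (intro mult_left_mono) auto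
    with contraction[of k] show ?case by (simp add: mult_ac)
  qed simp
  have M_lim: "(\<lambda>k. M_norm M (\<lambda>a. z k a - zs a)) \<longlonglongrightarrow> 0"
    by (rule tendsto_of_power_bound[of \<rho> _ _ "V 0"]) (use \<rho> V_eq V_power in auto)
  have x_bound: "(norm (x (Suc k) - xs))\<^sup>2 \<le> 1 / (2 * m) * V k" for k
  proof -
    have "2 * (m * (norm (w (Suc k)))\<^sup>2) \<le> V k"
      using m(2)[of "x (Suc k)" xs] descent[of k] V_nonneg[of "Suc k"] Q_nonneg[of k]
      unfolding w_def by linarith
    then show ?thesis using m(1) by (simp add: w_def field_simps)
  qed
  \<comment> \<open>\<open>x\<close> lags one step behind the energy: division by \<open>\<rho>\<close> shifts the index, and the first
    summand covers the arbitrary initial point\<close>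
  define D where "D = (norm (x 0 - xs))\<^sup>2 + V 0 / (2 * m * \<rho>)"
  have x_power: "(norm (x k - xs))\<^sup>2 \<le> D * \<rho> ^ k" for k
  proof (cases k)
    case 0
    then show ?thesis using V_nonneg[of 0] m(1) \<rho> by (simp add: D_def)
  next
    case (Suc j)
    have "(norm (x k - xs))\<^sup>2 \<le> 1 / (2 * m) * V j" using x_bound Suc by simp
    also have "\<dots> \<le> 1 / (2 * m) * (V 0 * \<rho> ^ j)" using V_power m(1) by (intro mult_left_mono) auto
    also have "\<dots> = V 0 / (2 * m * \<rho>) * \<rho> ^ k" using Suc \<rho> by simp
    also have "\<dots> \<le> D * \<rho> ^ k" using \<rho> by (intro mult_right_mono) (auto simp: D_def)
    finally show ?thesis .
  qed
  have "x \<longlonglongrightarrow> xs"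
    by (rule tendsto_of_power_bound[of \<rho> _ _ D]) (use \<rho> x_power in auto)
  moreover have "(\<lambda>k. (norm (x k - xs))\<^sup>2) \<in> O(\<lambda>k. \<rho> ^ k)"
    by (rule bigoI[of _ D]) (use \<rho> x_power in auto)
  ultimately show ?thesis
    using \<delta> contraction M_lim unfolding V_eq \<rho>_def by blast
qed

end
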